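(* Let $n, d, \theta, \rho$ be positive integers such that $\theta\rho = nd$ and $n \leq \binom{\theta}{d}$. Then there exists a fractional repetition code with repetition degree $\rho$ for an $(n,k,d)$ DSS on the set $\Omega = \{1,\dots,\theta\}$; that is, there exist $n$ pairwise distinct subsets $V_1, V_2, \dots, V_n$ of $\Omega$, each of cardinality $d$, such that each element of $\Omega$ belongs to exactly $\rho$ of the sets $V_1,\dots,V_n$.
   Context: A fractional repetition (FR) code $\mathcal{C}$ with repetition degree $\rho$ for an $(n,k,d)$ DSS (distributed storage system) is a collection $\mathcal{C}$ of $n$ (distinct) subsets $V_1, V_2, \dots, V_n$ of a set $\Omega = \{1,\dots,\theta\}$, each of cardinality $d$, satisfying the condition that each element of $\Omega$ belongs to exactly $\rho$ sets in the collection. The parameter $k$ of the DSS imposes no condition on the collection. The symbol $\binom{\theta}{d}$ is the usual binomial coefficient, equal to $0$ if $d > \theta$. *)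

theory Defs
  imports Complex_Main
begin

text \<open>
  A fractional repetition code with repetition degree \<open>\<rho>\<close> for an \<open>(n,k,d)\<close> distributed
  storage system, on the ground set \<open>{1..\<theta>}\<close>. The collection is the family
  \<open>V 1, \<dots>, V n\<close>; values of \<open>V\<close> outside \<open>{1..n}\<close> are irrelevant. The parameter \<open>k\<close> of the
  storage system imposes no condition on the collection.
\<close>

definition fr_code ::
  "nat \<Rightarrow> nat \<Rightarrow> nat \<Rightarrow> nat \<Rightarrow> nat \<Rightarrow> (nat \<Rightarrow> nat set) \<Rightarrow> bool" where
  "fr_code n k d \<theta> \<rho> V \<longleftrightarrow>
     inj_on V {1..n} \<and>
     (\<forall>i\<in>{1..n}. V i \<subseteq> {1..\<theta>} \<and> card (V i) = d) \<and>
     (\<forall>x\<in>{1..\<theta>}. card {i \<in> {1..n}. x \<in> V i} = \<rho>)"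

end

(*
  Among all families of n distinct d-subsets choose one whose total excess of degrees over rho is
  minimal. If it is not regular, averaging yields points x, y of degree above and below rho.
  Replacing x by y is injective on the members that contain x but not y, and these outnumber the
  members that contain y but not x; so some member can be exchanged for a set outside the family,
  which lowers the excess.
*)

theory Submission
  imports Defs
begin

definition degree :: "'a set set \<Rightarrow> 'a \<Rightarrow> nat" where
  "degree F x = card {S \<in> F. x \<in> S}"

text \<open>Families are sets of sets, so that distinctness of the members is automatic; an indexing
  by \<open>{1..n}\<close> is chosen only at the very end.\<close>

definition uniform_families :: "'a set \<Rightarrow> nat \<Rightarrow> nat \<Rightarrow> 'a set set set" where
  "uniform_families \<Omega> d n = {F. F \<subseteq> {S. S \<subseteq> \<Omega> \<and> card S = d} \<and> card F = n}"

lemma uniform_families_finite: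
  assumes "finite \<Omega>" "F \<in> uniform_families \<Omega> d n"
  shows "finite F"
proof (rule finite_subset)
  show "F \<subseteq> Pow \<Omega>" using assms(2) by (auto simp: uniform_families_def)
qed (use assms(1) in simp)

text \<open>Double counting of the incident pairs of a point and a member.\<close>

lemma sum_degree:
  assumes "finite \<Omega>" "F \<in> uniform_families \<Omega> d n"
  shows "(\<Sum>x\<in>\<Omega>. degree F x) = n * d"
proof -
  have fin: "finite F" by (rule uniform_families_finite[OF assms])
  have "(\<Sum>x\<in>\<Omega>. degree F x) = (\<Sum>S\<in>F. card {x \<in> \<Omega>. x \<in> S})"
    unfolding degree_def by (intro sum_multicount_gen assms(1) fin ballI refl)
  also have "\<dots> = (\<Sum>S\<in>F. d)"
  proof (rule sum.cong[OF refl])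
    fix S assume "S \<in> F"
    then have "S \<subseteq> \<Omega>" "card S = d" using assms(2) by (auto simp: uniform_families_def)
    then show "card {x \<in> \<Omega>. x \<in> S} = d"
      by (simp add: Collect_conj_eq inf.absorb2)
  qed
  also have "\<dots> = n * d" using assms(2) by (simp add: uniform_families_def)
  finally show ?thesis .
qed

lemma degree_insert:
  assumes "finite F" "T \<notin> F"
  shows "degree (insert T F) z = degree F z + (if z \<in> T then 1 else 0)"
proof -
  have "{S \<in> insert T F. z \<in> S} =
      (if z \<in> T then insert T {S \<in> F. z \<in> S} else {S \<in> F. z \<in> S})" by auto
  then show ?thesis using assms by (simp add: degree_def)
qed

lemma exists_exchange:
  assumes fin: "finite F" and lt: "degree F y < degree F x"
  shows "\<exists>S\<in>F. x \<in> S \<and> y \<notin> S \<and> insert y (S - {x}) \<notin> F"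
proof (rule ccontr)
  assume neg: "\<not> ?thesis"
  \<comment> \<open>Members in \<open>?C\<close> contribute equally to both degrees, so the gap
    between the degrees is a gap between \<open>?A\<close> and \<open>?B\<close>.\<close>
  let ?A = "{S \<in> F. x \<in> S \<and> y \<notin> S}" and ?B = "{S \<in> F. y \<in> S \<and> x \<notin> S}"
    and ?C = "{S \<in> F. x \<in> S \<and> y \<in> S}"
  have "degree F x = card (?A \<union> ?C)" "degree F y = card (?B \<union> ?C)"
    unfolding degree_def by (rule arg_cong[where f = card], auto)+
  moreover have "card (?A \<union> ?C) = card ?A + card ?C" "card (?B \<union> ?C) = card ?B + card ?C"
    by (rule card_Un_disjoint; use fin in auto)+
  ultimately have "card ?B < card ?A" using lt by simp
  moreover have "card ?A \<le> card ?B"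
  proof (rule card_inj_on_le)
    show "inj_on (\<lambda>S. insert y (S - {x})) ?A"
    proof (rule inj_onI)
      fix S T assume "S \<in> ?A" "T \<in> ?A" and eq: "insert y (S - {x}) = insert y (T - {x})"
      \<comment> \<open>The exchange is undone by removing \<open>y\<close> and restoring
        \<open>x\<close>, because members of \<open>?A\<close> contain \<open>x\<close> and omit
        \<open>y\<close>.\<close>
      then have "S = insert x (insert y (S - {x}) - {y})" "T = insert x (insert y (T - {x}) - {y})"
        by auto
      then show "S = T" by (metis eq)
    qed
    \<comment> \<open>By \<open>neg\<close>, every exchanged set is again a member of
      \<open>F\<close>.\<close>
    show "(\<lambda>S. insert y (S - {x})) ` ?A \<subseteq> ?B" using neg by auto
    show "finite ?B" using fin by simp
  qed
  ultimately show False by simp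
qed

lemma exchange_family:
  assumes "finite \<Omega>" "y \<in> \<Omega>" and F: "F \<in> uniform_families \<Omega> d n"
    and lt: "degree F y < degree F x"
  obtains F' where "F' \<in> uniform_families \<Omega> d n"
    and "degree F' x + 1 = degree F x" and "degree F' y = degree F y + 1"
    and "\<And>z. z \<noteq> x \<Longrightarrow> z \<noteq> y \<Longrightarrow> degree F' z = degree F z"
proof -
  have fin: "finite F" by (rule uniform_families_finite[OF assms(1) F])
  obtain S where S: "S \<in> F" "x \<in> S" "y \<notin> S" "insert y (S - {x}) \<notin> F"
    using exists_exchange[OF fin lt] by blast
  \<comment> \<open>Both families arise from \<open>G\<close> by inserting one new set,
    \<open>S\<close> or \<open>T\<close>. These sets differ only in \<open>x\<close> and
    \<open>y\<close>, so \<open>degree_insert\<close>, applied to each, compares all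
    degrees.\<close>
  define G where "G = F - {S}"
  define T where "T = insert y (S - {x})"
  have G: "finite G" "S \<notin> G" "T \<notin> G" "F = insert S G"
    using S fin by (auto simp: G_def T_def)
  have sub: "S \<subseteq> \<Omega>" "card S = d" using F S(1) by (auto simp: uniform_families_def)
  have finS: "finite S" using sub(1) assms(1) finite_subset by blast
  have "card T = card S"
    using S finS card_Suc_Diff1[OF finS S(2)] by (simp add: T_def)
  then have "insert T G \<in> uniform_families \<Omega> d n"
    using F G S assms(2) sub by (auto simp: uniform_families_def T_def)
  moreover have "x \<noteq> y" using S by auto
  ultimately show thesis
    using S G by (intro that[of "insert T G"]) (auto simp: degree_insert T_def)
qed

lemma exists_regular_uniform_family:
  assumes fin: "finite \<Omega>" and count: "card \<Omega> * \<rho> = n * d" and n: "n \<le> card \<Omega> choose d"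
  obtains F where "F \<in> uniform_families \<Omega> d n" and "\<And>x. x \<in> \<Omega> \<Longrightarrow> degree F x = \<rho>"
proof -
  \<comment> \<open>Subtraction on naturals truncates: points of degree at most
    \<open>\<rho>\<close> contribute 0, so surpluses are not cancelled by deficits.\<close>
  define excess where "excess F = (\<Sum>x\<in>\<Omega>. degree F x - \<rho>)" for F
  \<comment> \<open>The binomial bound enters here: there are enough d-subsets to form a first
    family, and a minimiser of the natural number \<open>excess\<close> then exists.\<close>
  have "n \<le> card {S. S \<subseteq> \<Omega> \<and> card S = d}" using n n_subsets[OF fin] by simp
  then obtain F0 where "F0 \<in> uniform_families \<Omega> d n"
    unfolding uniform_families_def by (metis (mono_tags, lifting) mem_Collect_eq obtain_subset_with_card_n)
  then obtain F where F: "F \<in> uniform_families \<Omega> d n"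
    and min: "\<And>F'. F' \<in> uniform_families \<Omega> d n \<Longrightarrow> excess F \<le> excess F'"
    using arg_min_nat_lemma[of "\<lambda>F. F \<in> uniform_families \<Omega> d n" F0 excess] by blast
  have sum: "(\<Sum>x\<in>\<Omega>. degree F x) = (\<Sum>x\<in>\<Omega>. \<rho>)"
    using sum_degree[OF fin F] count by simp
  have le: "degree F x \<le> \<rho>" if x: "x \<in> \<Omega>" for x
  proof (rule ccontr)
    assume gt: "\<not> degree F x \<le> \<rho>"
    have "\<exists>y\<in>\<Omega>. degree F y < \<rho>"
    proof (rule ccontr)
      assume "\<not> (\<exists>y\<in>\<Omega>. degree F y < \<rho>)"
      then have "(\<Sum>x\<in>\<Omega>. \<rho>) < (\<Sum>x\<in>\<Omega>. degree F x)"
        using x gt by (intro sum_strict_mono_ex1[OF fin]) (auto simp: not_less not_le)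
      then show False using sum by simp
    qed
    then obtain y where y: "y \<in> \<Omega>" "degree F y < \<rho>" by blast
    obtain F' where F': "F' \<in> uniform_families \<Omega> d n"
      "degree F' x + 1 = degree F x" "degree F' y = degree F y + 1"
      "\<And>z. z \<noteq> x \<Longrightarrow> z \<noteq> y \<Longrightarrow> degree F' z = degree F z"
      using exchange_family[OF fin y(1) F, of x] gt y(2) by auto
    have "excess F' < excess F"
      unfolding excess_def
    proof (rule sum_strict_mono_ex1[OF fin])
      \<comment> \<open>Since \<open>y\<close> starts strictly below \<open>\<rho>\<close>, its
        raised degree is still at most \<open>\<rho>\<close> and its term stays 0. The term of
        \<open>x\<close> drops by one because its degree exceeded \<open>\<rho>\<close>.\<close>
      show "\<forall>z\<in>\<Omega>. degree F' z - \<rho> \<le> degree F z - \<rho>"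
      proof
        fix z
        show "degree F' z - \<rho> \<le> degree F z - \<rho>"
          using F'(2,3) F'(4)[of z] y(2) by (cases "z = x"; cases "z = y") auto
      qed
      show "\<exists>z\<in>\<Omega>. degree F' z - \<rho> < degree F z - \<rho>"
        using x gt F'(2) by (intro bexI[of _ x]) auto
    qed
    then show False using min[OF F'(1)] by simp
  qed
  show thesis
  proof (rule that[OF F])
    fix x assume x: "x \<in> \<Omega>"
    show "degree F x = \<rho>"
      \<comment> \<open>No degree exceeds \<open>\<rho>\<close>, yet the sums agree, so equality
        holds at each point.\<close>
      by (rule sum_mono_inv[OF sum le x fin])
  qed
qed

theorem theoremI1:
  fixes n k d \<theta> \<rho> :: nat
  assumes "n > 0" and "d > 0" and "\<theta> > 0" and "\<rho> > 0"
    and "\<theta> * \<rho> = n * d"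
    and "n \<le> \<theta> choose d"
  shows "\<exists>V. fr_code n k d \<theta> \<rho> V"
proof -
  obtain F where F: "F \<in> uniform_families {1..\<theta>} d n"
    and deg: "\<And>x. x \<in> {1..\<theta>} \<Longrightarrow> degree F x = \<rho>"
    using exists_regular_uniform_family[of "{1..\<theta>}" \<rho> n d] assms by auto
  have "finite F" by (rule uniform_families_finite[OF _ F]) simp
  moreover have "card F = n" using F by (simp add: uniform_families_def)
  ultimately obtain V where V: "bij_betw V {1..n} F"
    using ex_bij_betw_nat_finite_1 by blast
  have "card {i \<in> {1..n}. x \<in> V i} = degree F x" for x
  proof -
    \<comment> \<open>The enumeration restricts to a bijection from the indices counted in
      \<open>fr_code\<close> to the members counted by \<open>degree\<close>.\<close>
    have "bij_betw V {i \<in> {1..n}. x \<in> V i} {S \<in> F. x \<in> S}"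
      by (rule bij_betw_subset[OF V]) (use bij_betw_imp_surj_on[OF V] in blast)+
    then show ?thesis unfolding degree_def by (rule bij_betw_same_card)
  qed
  moreover have "V i \<in> F" if "i \<in> {1..n}" for i using bij_betwE[OF V] that by blast
  ultimately have "fr_code n k d \<theta> \<rho> V"
    using V F deg by (auto simp: fr_code_def bij_betw_def uniform_families_def)
  then show ?thesis by blast
qed

end
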